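(* Suppose that for every $x\in\mathcal{X}$ and $A\in\mathcal{B}(\mathcal{X})$ the map $u\mapsto Q(A|x,u)$ is continuous on $\mathcal{U}$. Let $\nu$ be a non-negative measure supported on $\bar{\mathcal{X}}$. For every $k\in\{0,\dots,T-1\}$, let $\mathcal{F}^{M_k}$ denote the span of a fixed set of $M_k$ basis elements $\{\phi^k_i\}_{i=1}^{M_k}\subset\mathcal{F}$, each $\nu$-integrable on $\bar{\mathcal{X}}$. Start with $\hat V_T=V^*_T$ and, for $k=T-1,\dots,0$, recursively construct $\hat V_k=\sum_{i=1}^{M_k}\hat w^k_i\phi^k_i$, where $\hat w^k\in\mathbb{R}^{M_k}$ is a solution (assumed to exist) of the semi-infinite linear program $$\min_{w\in\mathbb{R}^{M_k}}\ \sum_{i=1}^{M_k}w_i\int_{\bar{\mathcal{X}}}\phi^k_i(x)\,\nu(dx)\quad\text{subject to}\quad \sum_{i=1}^{M_k}w_i\phi^k_i(x)\ge\mathcal{T}_u[\hat V_{k+1}](x)\quad\forall(x,u)\in\bar{\mathcal{X}}\times\mathcal{U},$$ where, whenever $\mathcal{T}_u$ is applied to $\hat V_{k+1}$, the function $\hat V_{k+1}$ is understood to be given by its basis expansion on $\bar{\mathcal{X}}$ (for $k+1<T$) and to be set equal to $1$ on $K$ and $0$ on $\mathcal{X}\setminus K'$. Then: (a) for each $k\in\{0,\dots,T-1\}$, $\hat V_k$ is also a solution to the problem $$\min_{V\in\mathcal{F}^{M_k}}\ \|V-V^*_k\|_{1,\nu}\quad\text{subject to}\quad V(x)\ge\mathcal{T}_u[\hat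 V_{k+1}](x)\quad\forall(x,u)\in\bar{\mathcal{X}}\times\mathcal{U};$$ (b) $\hat V_k(x)\ge V^*_k(x)$ for all $x\in\bar{\mathcal{X}}$ and all $k=0,\dots,T-1$.
   Context: Setting: $\mathcal{X}\subseteq\mathbb{R}^n$ is the state space with Borel $\sigma$-algebra $\mathcal{B}(\mathcal{X})$; $\mathcal{U}\subseteq\mathbb{R}^m$ is a nonempty compact control space. $Q$ is a Borel-measurable stochastic kernel on $\mathcal{X}$ given $\mathcal{X}\times\mathcal{U}$: $Q(A|\cdot)$ is Borel measurable on $\mathcal{X}\times\mathcal{U}$ for each $A\in\mathcal{B}(\mathcal{X})$ and $Q(\cdot|x,u)$ is a probability measure on $\mathcal{X}$ for each $(x,u)$. "Measurable" means Borel measurable. $K\subseteq K'$ are Borel subsets of $\mathcal{X}$ (target set and safe set) and $\bar{\mathcal{X}}:=K'\setminus K$. $T\in\mathbb{N}$ is the time horizon, and $\mathds{1}_A$ denotes the indicator function of a set $A$. Value functions $V^*_k:\mathcal{X}\to[0,1]$, $k=T,T-1,\dots,0$, are defined by $$V^*_T(x)=\mathds{1}_K(x),\qquad V^*_k(x)=\sup_{u\in\mathcal{U}}\Big\{\mathds{1}_K(x)+\mathds{1}_{\bar{\mathcal{X}}}(x)\int_{\mathcal{X}}V^*_{k+1}(y)\,Q(dy|x,u)\Big\}.$$ $\mathcal{F}:=\{f:\mathcal{X}\to\mathbb{R}: f\text{ measurable}\}$, $\mathcal{T}_u[V](x):=\int_{\mathcal{X}}V(y)\,Q(dy|x,u)$,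 and $\|V\|_{1,\nu}:=\int_{\bar{\mathcal{X}}}|V(x)|\,\nu(dx)$. *)

theory Defs
  imports "HOL-Probability.Probability"
begin

text \<open>
  Functions on the state space are total functions of which only the values on the
  state space are ever used.
\<close>

abbreviation borel_on :: "'a::topological_space set \<Rightarrow> 'a measure" where
  "borel_on X \<equiv> restrict_space borel X"

text \<open>
  A Markov kernel in the sense of the Giry monad: each \<open>Q x u\<close> is a probability
  measure on the Borel sets of \<open>X\<close>, and \<open>(x, u) \<mapsto> Q x u A\<close> is Borel measurable for
  every Borel set \<open>A\<close> (the lemma below).
\<close>

definition stochastic_kernel ::
  "'a::euclidean_space set \<Rightarrow> 'b::euclidean_space set \<Rightarrow> ('a \<Rightarrow> 'b \<Rightarrow> 'a measure) \<Rightarrow> bool" where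
  "stochastic_kernel X U Q \<longleftrightarrow>
     (\<lambda>(x, u). Q x u) \<in> borel_on X \<Otimes>\<^sub>M borel_on U \<rightarrow>\<^sub>M prob_algebra (borel_on X)"

lemma stochastic_kernel_iff:
  "stochastic_kernel X U Q \<longleftrightarrow>
     (\<forall>x\<in>X. \<forall>u\<in>U. prob_space (Q x u) \<and> sets (Q x u) = sets (borel_on X)) \<and>
     (\<forall>A\<in>sets (borel_on X).
        (\<lambda>(x, u). measure (Q x u) A) \<in> borel_measurable (borel_on X \<Otimes>\<^sub>M borel_on U))"
  (is "?L \<longleftrightarrow> ?P \<and> ?M")
proof (intro iffI conjI)
  assume ?L
  then have Q: "(\<lambda>(x, u). Q x u) \<in> borel_on X \<Otimes>\<^sub>M borel_on U \<rightarrow>\<^sub>M prob_algebra (borel_on X)"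
    by (simp add: stochastic_kernel_def)
  from measurable_space[OF Q] show ?P
    by (auto simp: space_pair_measure space_prob_algebra space_restrict_space)
  show ?M
  proof
    fix A assume A: "A \<in> sets (borel_on X)"
    have "(\<lambda>p. emeasure ((\<lambda>(x, u). Q x u) p) A) \<in> borel_measurable (borel_on X \<Otimes>\<^sub>M borel_on U)"
      by (rule measurable_emeasure_kernel[OF measurable_prob_algebraD[OF Q] A])
    then show "(\<lambda>(x, u). measure (Q x u) A) \<in> borel_measurable (borel_on X \<Otimes>\<^sub>M borel_on U)"
      unfolding measure_def by (simp add: split_beta')
  qed
next
  assume R: "?P \<and> ?M"
  show ?L unfolding stochastic_kernel_def
  proof (rule measurable_prob_algebraI)
    fix p assume "p \<in> space (borel_on X \<Otimes>\<^sub>M borel_on U)"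
    then show "prob_space (case p of (x, u) \<Rightarrow> Q x u)"
      using R by (auto simp: space_pair_measure space_restrict_space)
  next
    show "(\<lambda>(x, u). Q x u) \<in> borel_on X \<Otimes>\<^sub>M borel_on U \<rightarrow>\<^sub>M subprob_algebra (borel_on X)"
    proof (rule measurable_subprob_algebra)
      fix p assume p: "p \<in> space (borel_on X \<Otimes>\<^sub>M borel_on U)"
      show "subprob_space (case p of (x, u) \<Rightarrow> Q x u)"
        using R p by (auto simp: space_pair_measure space_restrict_space
            intro!: prob_space_imp_subprob_space)
      show "sets (case p of (x, u) \<Rightarrow> Q x u) = sets (borel_on X)"
        using R p by (auto simp: space_pair_measure space_restrict_space)
    next
      fix A assume A: "A \<in> sets (borel_on X)"
      have "(\<lambda>p. ennreal (measure ((\<lambda>(x, u). Q x u) p) A))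
              \<in> borel_measurable (borel_on X \<Otimes>\<^sub>M borel_on U)"
        using R A by (simp add: split_beta')
      then show "(\<lambda>p. emeasure (case p of (x, u) \<Rightarrow> Q x u) A)
                   \<in> borel_measurable (borel_on X \<Otimes>\<^sub>M borel_on U)"
      proof (rule measurable_cong[THEN iffD1, rotated])
        fix p assume "p \<in> space (borel_on X \<Otimes>\<^sub>M borel_on U)"
        then have "prob_space (case p of (x, u) \<Rightarrow> Q x u)"
          using R by (auto simp: space_pair_measure space_restrict_space)
        then show "ennreal (measure (case p of (x, u) \<Rightarrow> Q x u) A)
                     = emeasure (case p of (x, u) \<Rightarrow> Q x u) A"
          by (simp add: finite_measure.emeasure_eq_measure prob_space.finite_measure)
      qed
    qed
  qed
qed

text \<open>Value function with \<open>j\<close> steps to go, so that \<open>V\<^sup>*\<^sub>k\<close> is \<open>value_to_go\<close> at \<open>T - k\<close>.\<close>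

primrec value_to_go ::
  "'b set \<Rightarrow> ('a \<Rightarrow> 'b \<Rightarrow> 'a measure) \<Rightarrow> 'a set \<Rightarrow> 'a set \<Rightarrow> nat \<Rightarrow> 'a \<Rightarrow> real" where
  "value_to_go U Q K K' 0 = (\<lambda>x. indicator K x)"
| "value_to_go U Q K K' (Suc j) =
     (\<lambda>x. SUP u\<in>U. indicator K x
            + indicator (K' - K) x * (\<integral>y. value_to_go U Q K K' j y \<partial>Q x u))"

definition opt_value ::
  "'b set \<Rightarrow> ('a \<Rightarrow> 'b \<Rightarrow> 'a measure) \<Rightarrow> 'a set \<Rightarrow> 'a set \<Rightarrow> nat \<Rightarrow> nat \<Rightarrow> 'a \<Rightarrow> real" where
  "opt_value U Q K K' T k = value_to_go U Q K K' (T - k)"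

lemma opt_value_final: "opt_value U Q K K' T T x = indicator K x"
  by (simp add: opt_value_def)

lemma opt_value_step:
  assumes "k < T"
  shows "opt_value U Q K K' T k x =
    (SUP u\<in>U. indicator K x
       + indicator (K' - K) x * (\<integral>y. opt_value U Q K K' T (Suc k) y \<partial>Q x u))"
  using assms by (simp add: opt_value_def flip: Suc_diff_Suc)

text \<open>
  The integral of \<open>V\<close> as positive part minus negative part, with values in the extended
  reals. The Bochner integral is not used here because it is \<open>0\<close> on functions that are not
  integrable, which would turn the infinite values of the integral of a nonnegative function
  into a vacuous constraint. On integrable functions both agree (the lemma below).
\<close>

definition transition_op ::
  "('a \<Rightarrow> 'b \<Rightarrow> 'a measure) \<Rightarrow> 'b \<Rightarrow> ('a \<Rightarrow> real) \<Rightarrow> 'a \<Rightarrow> ereal" where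
  "transition_op Q u V x =
     enn2ereal (\<integral>\<^sup>+y. ennreal (V y) \<partial>Q x u) - enn2ereal (\<integral>\<^sup>+y. ennreal (- V y) \<partial>Q x u)"

lemma transition_op_integrable:
  assumes "integrable (Q x u) V"
  shows "transition_op Q u V x = ereal (\<integral>y. V y \<partial>Q x u)"
proof -
  have fin: "(\<integral>\<^sup>+y. ennreal (V y) \<partial>Q x u) \<noteq> \<infinity>" "(\<integral>\<^sup>+y. ennreal (- V y) \<partial>Q x u) \<noteq> \<infinity>"
    using assms by (auto simp: real_integrable_def)
  then obtain a b where "0 \<le> a" "(\<integral>\<^sup>+y. ennreal (V y) \<partial>Q x u) = ennreal a"
    and "0 \<le> b" "(\<integral>\<^sup>+y. ennreal (- V y) \<partial>Q x u) = ennreal b"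
    by (metis ennreal_cases infinity_ennreal_def)
  then show ?thesis
    by (simp add: transition_op_def real_lebesgue_integral_def[OF assms])
qed

definition norm_L1 :: "'a set \<Rightarrow> 'a measure \<Rightarrow> ('a \<Rightarrow> real) \<Rightarrow> ennreal" where
  "norm_L1 B \<nu> V = (\<integral>\<^sup>+x\<in>B. ennreal \<bar>V x\<bar> \<partial>\<nu>)"

text \<open>
  Coefficient vectors in \<open>\<real>\<^sup>M\<close> are functions on \<open>nat\<close> of which only the entries
  \<open>1, \<dots>, M\<close> are used.
\<close>

definition basis_comb :: "nat \<Rightarrow> (nat \<Rightarrow> 'a \<Rightarrow> real) \<Rightarrow> (nat \<Rightarrow> real) \<Rightarrow> 'a \<Rightarrow> real" where
  "basis_comb M \<phi> w x = (\<Sum>i=1..M. w i * \<phi> i x)"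

definition basis_span :: "nat \<Rightarrow> (nat \<Rightarrow> 'a \<Rightarrow> real) \<Rightarrow> ('a \<Rightarrow> real) set" where
  "basis_span M \<phi> = range (basis_comb M \<phi>)"

definition extend_value :: "'a set \<Rightarrow> 'a set \<Rightarrow> ('a \<Rightarrow> real) \<Rightarrow> 'a \<Rightarrow> real" where
  "extend_value K K' V x = (if x \<in> K then 1 else if x \<in> K' then V x else 0)"

definition bellman_feasible ::
  "'b set \<Rightarrow> ('a \<Rightarrow> 'b \<Rightarrow> 'a measure) \<Rightarrow> 'a set \<Rightarrow> 'a set \<Rightarrow> ('a \<Rightarrow> real) \<Rightarrow> ('a \<Rightarrow> real) \<Rightarrow> bool" where
  "bellman_feasible U Q K K' W V \<longleftrightarrow>
     (\<forall>x\<in>K' - K. \<forall>u\<in>U. ereal (V x) \<ge> transition_op Q u (extend_value K K' W) x)"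

text \<open>\<open>W\<close> is the approximation of the value function at the next time step.\<close>

definition lp_solution ::
  "'b set \<Rightarrow> ('a \<Rightarrow> 'b \<Rightarrow> 'a measure) \<Rightarrow> 'a set \<Rightarrow> 'a set \<Rightarrow> 'a measure \<Rightarrow> nat \<Rightarrow> (nat \<Rightarrow> 'a \<Rightarrow> real)
     \<Rightarrow> ('a \<Rightarrow> real) \<Rightarrow> (nat \<Rightarrow> real) \<Rightarrow> bool" where
  "lp_solution U Q K K' \<nu> M \<phi> W w \<longleftrightarrow>
     is_arg_min (\<lambda>w. \<Sum>i=1..M. w i * (LINT x:K' - K|\<nu>. \<phi> i x))
       (\<lambda>w. bellman_feasible U Q K K' W (basis_comb M \<phi> w)) w"

definition L1_solution ::
  "'b set \<Rightarrow> ('a \<Rightarrow> 'b \<Rightarrow> 'a measure) \<Rightarrow> 'a set \<Rightarrow> 'a set \<Rightarrow> 'a measure \<Rightarrow> nat \<Rightarrow> (nat \<Rightarrow> 'a \<Rightarrow> real)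
     \<Rightarrow> ('a \<Rightarrow> real) \<Rightarrow> ('a \<Rightarrow> real) \<Rightarrow> ('a \<Rightarrow> real) \<Rightarrow> bool" where
  "L1_solution U Q K K' \<nu> M \<phi> W Vopt V \<longleftrightarrow>
     is_arg_min (\<lambda>V. norm_L1 (K' - K) \<nu> (\<lambda>x. V x - Vopt x))
       (\<lambda>V. V \<in> basis_span M \<phi> \<and> bellman_feasible U Q K K' W V) V"

end

theory Submission
  imports Defs
begin

text \<open>
  By backward induction every function satisfying the Bellman inequality for \<open>V_hat (Suc k)\<close>
  dominates \<open>V\<^sup>*\<^sub>k\<close> on \<open>K' - K\<close>, which is (b). Hence \<open>\<bar>V - V\<^sup>*\<^sub>k\<bar> = V - V\<^sup>*\<^sub>k\<close> there for every feasible
  \<open>V\<close>, so the norm and the linear objective differ by the constant \<open>\<integral>V\<^sup>*\<^sub>k \<partial>\<nu>\<close>, which gives (a).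
  This argument needs no measurability of \<open>V\<^sup>*\<^sub>k\<close>: the Bochner integral of a nonmeasurable function is \<open>0\<close>,
  and subtracting a fixed nonmeasurable function preserves inequalities between
  nonnegative Lebesgue integrals.
\<close>

text \<open>
  Nonmeasurable \<open>f\<close> and \<open>f'\<close> are handled through simple functions \<open>s \<le> f\<close>: then \<open>s + g' - g\<close> is
  measurable and lies below \<open>f'\<close>.
\<close>

lemma nn_integral_mono_shift:
  fixes f f' g g' :: "'a \<Rightarrow> ennreal"
  assumes [measurable]: "g \<in> borel_measurable M" "g' \<in> borel_measurable M"
    and fin: "\<And>x. g x \<noteq> \<top>" "(\<integral>\<^sup>+x. g' x \<partial>M) \<noteq> \<top>"
    and le: "(\<integral>\<^sup>+x. g x \<partial>M) \<le> (\<integral>\<^sup>+x. g' x \<partial>M)"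
    and shift: "\<And>x. f x + g' x \<le> f' x + g x"
  shows "(\<integral>\<^sup>+x. f x \<partial>M) \<le> (\<integral>\<^sup>+x. f' x \<partial>M)"
  unfolding nn_integral_def[of M f]
proof (rule SUP_least)
  fix s assume "s \<in> {s. simple_function M s \<and> s \<le> f}"
  then have s: "simple_function M s" and s_le: "\<And>x. s x \<le> f x"
    by (auto simp: le_fun_def)
  have [measurable]: "s \<in> borel_measurable M"
    using s by (rule borel_measurable_simple_function)
  define t where "t x = s x + g' x - g x" for x
  have [measurable]: "t \<in> borel_measurable M"
    unfolding t_def by measurable
  have t_le: "t x \<le> f' x" for x
  proof -
    have "s x + g' x \<le> g x + f' x"
      using order_trans[OF add_right_mono[OF s_le] shift] by (simp add: add.commute)
    then show ?thesis
      using fin(1)[of x] by (simp add: t_def ennreal_minus_le_iff)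
  qed
  \<comment> \<open>Subtraction on \<open>ennreal\<close> truncates at 0, so adding
    \<open>g x\<close> back yields an inequality rather than an equality.\<close>
  have "s x + g' x \<le> t x + g x" for x
    unfolding t_def using ennreal_minus_le_iff[of "s x + g' x" "g x" "s x + g' x - g x"] fin(1)[of x] by (simp add: add.commute)
  then have "(\<integral>\<^sup>+x. s x + g' x \<partial>M) \<le> (\<integral>\<^sup>+x. t x + g x \<partial>M)"
    by (intro nn_integral_mono)
  \<comment> \<open>\<open>le\<close> trades the integral of \<open>g\<close> for that of
    \<open>g'\<close>, which is finite and can therefore be cancelled.\<close>
  also have "\<dots> \<le> (\<integral>\<^sup>+x. t x \<partial>M) + (\<integral>\<^sup>+x. g' x \<partial>M)"
    by (simp add: nn_integral_add le add_left_mono)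
  finally have "(\<integral>\<^sup>+x. s x \<partial>M) \<le> (\<integral>\<^sup>+x. t x \<partial>M)"
    using fin(2) by (simp add: nn_integral_add add.commute[of _ "integral\<^sup>N M g'"] ennreal_add_left_cancel_le)
  also have "\<dots> \<le> (\<integral>\<^sup>+x. f' x \<partial>M)"
    by (intro nn_integral_mono t_le)
  finally show "integral\<^sup>S M s \<le> (\<integral>\<^sup>+x. f' x \<partial>M)"
    by (simp add: nn_integral_eq_simple_integral[OF s])
qed

text \<open>Off \<open>K' - K\<close> the term under the supremum does not depend on
  \<open>u\<close>, and the supremum of a constant over a nonempty set is that constant.\<close>

lemma value_to_go_outside:
  assumes "U \<noteq> {}" "x \<notin> K' - K"
  shows "value_to_go U Q K K' j x = indicator K x"
  using assms by (cases j) auto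

lemma value_to_go_bounds:
  assumes "U \<noteq> {}" and Q: "\<And>x u. x \<in> K' - K \<Longrightarrow> u \<in> U \<Longrightarrow> prob_space (Q x u)"
  shows "0 \<le> value_to_go U Q K K' j x \<and> value_to_go U Q K K' j x \<le> 1"
proof (induction j arbitrary: x)
  case 0
  show ?case by (simp add: indicator_def)
next
  case (Suc j)
  show ?case
  proof (cases "x \<in> K' - K")
    case False
    then show ?thesis
      using value_to_go_outside[OF \<open>U \<noteq> {}\<close> False, of Q "Suc j"] by (simp add: indicator_def)
  next
    case True
    let ?I = "\<lambda>u. \<integral>y. value_to_go U Q K K' j y \<partial>Q x u"
    have I: "0 \<le> ?I u" "?I u \<le> 1" if "u \<in> U" for u
    proof -
      interpret prob_space "Q x u" by (rule Q[OF True that])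
      show "0 \<le> ?I u" using Suc.IH by (simp add: integral_nonneg)
      show "?I u \<le> 1"
        \<comment> \<open>Without integrability the Bochner integral takes the default value 0,
          which also lies below 1.\<close>
        using Suc.IH by (cases "integrable (Q x u) (value_to_go U Q K K' j)")
          (auto intro!: integral_le_const simp: not_integrable_integral_eq)
    qed
    have eq: "value_to_go U Q K K' (Suc j) x = (SUP u\<in>U. ?I u)"
      using True by simp
    obtain u where u: "u \<in> U" using \<open>U \<noteq> {}\<close> by blast
    \<comment> \<open>A real \<open>SUP\<close> bounds its members only when they are bounded above;
      the upper bound 1 supplies this.\<close>
    have "bdd_above (?I ` U)" using I(2) by (auto intro!: bdd_aboveI)
    from cSUP_upper[OF u this] I(1)[OF u] have "0 \<le> (SUP u\<in>U. ?I u)" by linarith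
    moreover have "(SUP u\<in>U. ?I u) \<le> 1"
      using I(2) \<open>U \<noteq> {}\<close> by (intro cSUP_least) auto
    ultimately show ?thesis unfolding eq by simp
  qed
qed

text \<open>\<open>Q x u\<close> may charge points outside \<open>K' - K\<close>, so integrals can
  be compared only after the bound is extended. On \<open>K\<close> both sides are 1, off
  \<open>K'\<close> both are 0.\<close>

lemma value_to_go_le_extend_value:
  assumes "U \<noteq> {}" "K \<subseteq> K'" "\<And>x. x \<in> K' - K \<Longrightarrow> value_to_go U Q K K' j x \<le> W x"
  shows "value_to_go U Q K K' j x \<le> extend_value K K' W x"
  using assms by (cases "x \<in> K' - K") (auto simp: extend_value_def value_to_go_outside)

lemma transition_op_nonneg:
  assumes "\<And>y. 0 \<le> V y"
  shows "transition_op Q u V x = enn2ereal (\<integral>\<^sup>+y. ennreal (V y) \<partial>Q x u)"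
  using assms by (simp add: transition_op_def ennreal_neg zero_ennreal.rep_eq)

text \<open>For integrable \<open>f\<close> this is monotonicity; otherwise the left side is 0. As
  \<open>V\<close> is nonnegative, its negative part contributes nothing to
  \<open>transition_op\<close>, whose value may be infinite.\<close>

lemma integral_le_transition_op:
  assumes "\<And>y. 0 \<le> f y" "\<And>y. f y \<le> V y"
  shows "ereal (\<integral>y. f y \<partial>Q x u) \<le> transition_op Q u V x"
proof -
  have "ennreal (\<integral>y. f y \<partial>Q x u) \<le> (\<integral>\<^sup>+y. ennreal (V y) \<partial>Q x u)"
  proof (cases "integrable (Q x u) f")
    case True
    then have "ennreal (\<integral>y. f y \<partial>Q x u) = (\<integral>\<^sup>+y. ennreal (f y) \<partial>Q x u)"
      using assms(1) by (simp add: nn_integral_eq_integral)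
    also have "\<dots> \<le> (\<integral>\<^sup>+y. ennreal (V y) \<partial>Q x u)"
      using assms(2) by (intro nn_integral_mono ennreal_leI)
    finally show ?thesis .
  qed (simp add: not_integrable_integral_eq)
  moreover have "0 \<le> (\<integral>y. f y \<partial>Q x u)"
    using assms(1) by (simp add: integral_nonneg)
  ultimately show ?thesis
    using order_trans[OF assms]
    by (simp add: transition_op_nonneg less_eq_ennreal.rep_eq enn2ereal_ennreal)
qed

text \<open>One step of the backward induction. The constraint makes \<open>V x\<close> an upper
  bound of the integrals for all \<open>u\<close>, hence of their supremum.\<close>

lemma bellman_feasible_ge_value:
  assumes "U \<noteq> {}" "K \<subseteq> K'" and Q: "\<And>x u. x \<in> K' - K \<Longrightarrow> u \<in> U \<Longrightarrow> prob_space (Q x u)"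
    and W: "\<And>x. x \<in> K' - K \<Longrightarrow> value_to_go U Q K K' j x \<le> W x"
    and feasible: "bellman_feasible U Q K K' W V"
    and x: "x \<in> K' - K"
  shows "value_to_go U Q K K' (Suc j) x \<le> V x"
proof -
  have "(\<integral>y. value_to_go U Q K K' j y \<partial>Q x u) \<le> V x" if u: "u \<in> U" for u
  proof -
    have "ereal (\<integral>y. value_to_go U Q K K' j y \<partial>Q x u)
            \<le> transition_op Q u (extend_value K K' W) x"
      using value_to_go_bounds[OF assms(1) Q] value_to_go_le_extend_value[OF assms(1,2) W]
      by (intro integral_le_transition_op) auto
    also have "\<dots> \<le> ereal (V x)"
      using feasible x u by (auto simp: bellman_feasible_def)
    finally show ?thesis by simp
  qed
  then show ?thesis
    using x \<open>U \<noteq> {}\<close> by (auto intro!: cSUP_least)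
qed

lemma
  assumes "\<And>i. i \<in> {1..M} \<Longrightarrow> set_integrable \<nu> B (\<phi> i)"
  shows set_integrable_basis_comb: "set_integrable \<nu> B (basis_comb M \<phi> w)"
    and set_integral_basis_comb:
      "(LINT x:B|\<nu>. basis_comb M \<phi> w x) = (\<Sum>i=1..M. w i * (LINT x:B|\<nu>. \<phi> i x))"
proof -
  have eq: "indicator B x *\<^sub>R basis_comb M \<phi> w x
              = (\<Sum>i=1..M. w i * (indicator B x *\<^sub>R \<phi> i x))" for x
    by (simp add: basis_comb_def sum_distrib_left mult.left_commute)
  have int: "integrable \<nu> (\<lambda>x. w i * (indicator B x *\<^sub>R \<phi> i x))" if "i \<in> {1..M}" for i
    using assms[OF that] unfolding set_integrable_def by (rule integrable_mult_right)
  then show "set_integrable \<nu> B (basis_comb M \<phi> w)"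
    unfolding set_integrable_def eq by (intro Bochner_Integration.integrable_sum)
  show "(LINT x:B|\<nu>. basis_comb M \<phi> w x) = (\<Sum>i=1..M. w i * (LINT x:B|\<nu>. \<phi> i x))"
    unfolding set_lebesgue_integral_def eq using int
    by (subst Bochner_Integration.integral_sum) simp_all
qed

lemma norm_L1_diff_mono:
  fixes f g h :: "'a \<Rightarrow> real"
  assumes f: "set_integrable \<nu> B f" and g: "set_integrable \<nu> B g"
    and h: "\<And>x. x \<in> B \<Longrightarrow> 0 \<le> h x" "\<And>x. x \<in> B \<Longrightarrow> h x \<le> f x" "\<And>x. x \<in> B \<Longrightarrow> h x \<le> g x"
    and le: "(LINT x:B|\<nu>. f x) \<le> (LINT x:B|\<nu>. g x)"
  shows "norm_L1 B \<nu> (\<lambda>x. f x - h x) \<le> norm_L1 B \<nu> (\<lambda>x. g x - h x)"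
proof -
  let ?R = "\<lambda>f x. indicator B x *\<^sub>R f x :: real"
  \<comment> \<open>Nonnegativity makes the coercion to \<open>ennreal\<close> lossless, so the
    integrals below agree.\<close>
  have nonneg: "0 \<le> ?R f x" "0 \<le> ?R g x" for x
    using h[of x] by (auto simp: indicator_def)
  have nn: "(\<integral>\<^sup>+x. ennreal (?R f x) \<partial>\<nu>) = ennreal (LINT x:B|\<nu>. f x)"
    "(\<integral>\<^sup>+x. ennreal (?R g x) \<partial>\<nu>) = ennreal (LINT x:B|\<nu>. g x)"
    using f g nonneg unfolding set_integrable_def set_lebesgue_integral_def
    by (auto intro!: nn_integral_eq_integral)
  show ?thesis
    unfolding norm_L1_def
  proof (rule nn_integral_mono_shift[where g = "\<lambda>x. ennreal (?R f x)" and g' = "\<lambda>x. ennreal (?R g x)"])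
    show "(\<lambda>x. ennreal (?R f x)) \<in> borel_measurable \<nu>"
      using borel_measurable_integrable[OF f[unfolded set_integrable_def]]
      by (rule measurable_compose[OF _ measurable_ennreal])
    show "(\<lambda>x. ennreal (?R g x)) \<in> borel_measurable \<nu>"
      using borel_measurable_integrable[OF g[unfolded set_integrable_def]]
      by (rule measurable_compose[OF _ measurable_ennreal])
    show "ennreal \<bar>f x - h x\<bar> * indicator B x + ennreal (?R g x)
            \<le> ennreal \<bar>g x - h x\<bar> * indicator B x + ennreal (?R f x)" for x
      using h[of x] by (auto simp: indicator_def simp flip: ennreal_plus)
  qed (simp_all only: nn ennreal_leI[OF le] ennreal_neq_top not_False_eq_True)
qed

text \<open>By linearity the objective of the program is the integral of the basis expansion, and
  \<open>Vopt\<close> lies below every feasible function, so \<open>norm_L1_diff_mono\<close> turns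
  the order of objectives into that of norms.\<close>

lemma lp_solution_imp_L1_solution:
  assumes \<phi>: "\<And>i. i \<in> {1..M} \<Longrightarrow> set_integrable \<nu> (K' - K) (\<phi> i)"
    and lp: "lp_solution U Q K K' \<nu> M \<phi> W w"
    and nonneg: "\<And>x. x \<in> K' - K \<Longrightarrow> 0 \<le> Vopt x"
    and ge: "\<And>V x. bellman_feasible U Q K K' W V \<Longrightarrow> x \<in> K' - K \<Longrightarrow> Vopt x \<le> V x"
  shows "L1_solution U Q K K' \<nu> M \<phi> W Vopt (basis_comb M \<phi> w)"
proof -
  have w: "bellman_feasible U Q K K' W (basis_comb M \<phi> w)"
    using lp by (simp add: lp_solution_def is_arg_min_def)
  have obj: "(LINT x:K' - K|\<nu>. basis_comb M \<phi> w' x) = (\<Sum>i=1..M. w' i * (LINT x:K' - K|\<nu>. \<phi> i x))" for w'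
    using \<phi> by (rule set_integral_basis_comb)
  have "norm_L1 (K' - K) \<nu> (\<lambda>x. basis_comb M \<phi> w x - Vopt x)
          \<le> norm_L1 (K' - K) \<nu> (\<lambda>x. basis_comb M \<phi> w' x - Vopt x)"
    \<comment> \<open>Coefficient vectors \<open>w'\<close> reach every competitor, since the span
      is the range of \<open>basis_comb\<close>.\<close>
    if w': "bellman_feasible U Q K K' W (basis_comb M \<phi> w')" for w'
  proof (rule norm_L1_diff_mono)
    show "(LINT x:K' - K|\<nu>. basis_comb M \<phi> w x) \<le> (LINT x:K' - K|\<nu>. basis_comb M \<phi> w' x)"
      using lp w' unfolding obj
      by (auto simp: lp_solution_def is_arg_min_def not_less)
  qed (use w w' nonneg ge \<phi> in \<open>auto intro: set_integrable_basis_comb\<close>)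
  then show ?thesis
    using w by (auto simp: L1_solution_def is_arg_min_def basis_span_def not_less)
qed

theorem proposition3:
  fixes X K K' :: "(real ^ 'n) set"
    and U :: "(real ^ 'm) set"
    and Q :: "real ^ 'n \<Rightarrow> real ^ 'm \<Rightarrow> (real ^ 'n) measure"
    and \<nu> :: "(real ^ 'n) measure"
    and T :: nat
    and M :: "nat \<Rightarrow> nat"
    and \<phi> :: "nat \<Rightarrow> nat \<Rightarrow> real ^ 'n \<Rightarrow> real"
    and w_hat :: "nat \<Rightarrow> nat \<Rightarrow> real"
    and V_hat :: "nat \<Rightarrow> real ^ 'n \<Rightarrow> real"
  assumes U: "compact U" "U \<noteq> {}"
    and Q: "stochastic_kernel X U Q"
    and K: "K \<in> sets (borel_on X)" "K' \<in> sets (borel_on X)" "K \<subseteq> K'"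
    and Q_cont: "\<And>x A. x \<in> X \<Longrightarrow> A \<in> sets (borel_on X) \<Longrightarrow>
                   continuous_on U (\<lambda>u. measure (Q x u) A)"
    and \<nu>: "sets \<nu> = sets (borel_on X)" "emeasure \<nu> (X - (K' - K)) = 0"
    and \<phi>_meas: "\<And>k i. k < T \<Longrightarrow> i \<in> {1..M k} \<Longrightarrow> \<phi> k i \<in> borel_measurable (borel_on X)"
    and \<phi>_int: "\<And>k i. k < T \<Longrightarrow> i \<in> {1..M k} \<Longrightarrow> set_integrable \<nu> (K' - K) (\<phi> k i)"
    and V_hat_T: "V_hat T = opt_value U Q K K' T T"
    and V_hat: "\<And>k. k < T \<Longrightarrow> V_hat k = basis_comb (M k) (\<phi> k) (w_hat k)"
    and w_hat: "\<And>k. k < T \<Longrightarrow>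
                  lp_solution U Q K K' \<nu> (M k) (\<phi> k) (V_hat (Suc k)) (w_hat k)"
  shows "(\<forall>k<T. L1_solution U Q K K' \<nu> (M k) (\<phi> k) (V_hat (Suc k))
                  (opt_value U Q K K' T k) (V_hat k)) \<and>
         (\<forall>k<T. \<forall>x\<in>K' - K. V_hat k x \<ge> opt_value U Q K K' T k x)"
proof -
  have Q_prob: "prob_space (Q x u)" if "x \<in> K' - K" "u \<in> U" for x u
    using that Q K(2) sets.sets_into_space[OF K(2)]
    by (auto simp: stochastic_kernel_iff space_restrict_space)
  have feasible: "bellman_feasible U Q K K' (V_hat (Suc k)) (V_hat k)" if "k < T" for k
    using w_hat[OF that] by (simp add: V_hat[OF that] lp_solution_def is_arg_min_def)
  \<comment> \<open>\<open>V\<close> is arbitrary: \<open>V_hat k\<close> is inserted for (b), every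
    competitor for (a).\<close>
  have dominated: "opt_value U Q K K' T k x \<le> V x"
    if "k < T" "\<And>x. x \<in> K' - K \<Longrightarrow> opt_value U Q K K' T (Suc k) x \<le> V_hat (Suc k) x"
      "bellman_feasible U Q K K' (V_hat (Suc k)) V" "x \<in> K' - K" for k V x
    \<comment> \<open>Time \<open>Suc k\<close> leaves \<open>T - Suc k\<close> steps to go, and
      \<open>Suc (T - Suc k) = T - k\<close> because \<open>k < T\<close>.\<close>
    using bellman_feasible_ge_value[OF U(2) K(3) Q_prob _ that(3,4), of "T - Suc k"] that(1,2)
    by (simp add: opt_value_def Suc_diff_Suc del: value_to_go.simps)
  \<comment> \<open>The range includes \<open>k = T\<close>, where equality holds, so the bound is
    available at \<open>Suc k\<close> for every \<open>k < T\<close>.\<close>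
  have ge: "opt_value U Q K K' T k x \<le> V_hat k x" if "k \<le> T" "x \<in> K' - K" for k x
    using that
  proof (induction k arbitrary: x rule: inc_induct)
    case base
    show ?case by (simp add: V_hat_T)
  next
    case (step k)
    show ?case
      by (rule dominated[OF \<open>k < T\<close> step.IH feasible[OF \<open>k < T\<close>] \<open>x \<in> K' - K\<close>])
  qed
  have "L1_solution U Q K K' \<nu> (M k) (\<phi> k) (V_hat (Suc k)) (opt_value U Q K K' T k) (V_hat k)"
    if k: "k < T" for k
  proof -
    have nonneg: "0 \<le> opt_value U Q K K' T k x" for x
      using value_to_go_bounds[OF U(2) Q_prob] by (simp add: opt_value_def)
    have le: "opt_value U Q K K' T k x \<le> V x"
      if "bellman_feasible U Q K K' (V_hat (Suc k)) V" "x \<in> K' - K" for V x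
      by (rule dominated[OF k ge that]) (use k in simp)
    have "L1_solution U Q K K' \<nu> (M k) (\<phi> k) (V_hat (Suc k)) (opt_value U Q K K' T k)
            (basis_comb (M k) (\<phi> k) (w_hat k))"
      using \<phi>_int[OF k] w_hat[OF k] nonneg le by (rule lp_solution_imp_L1_solution)
    then show ?thesis
      by (simp only: V_hat[OF k])
  qed
  then show ?thesis
    using ge by (simp add: less_imp_le)
qed

end
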